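(* Let $\alpha>0$ and let $n$ be the positive integer with $n-1<\alpha\le n$. Let $a,b\in\mathbb{R}$. (1) If $f$ is a real-valued function defined on $\mathbb{N}_a$ and at the points $a-1,\dots,a-n+1$ before $a$, then for all $t\in\mathbb{N}_{a+1}$ $${}^{C}\nabla_a^\alpha f(t)=\nabla_a^\alpha f(t)-\sum_{k=0}^{n-1}\frac{(t-a)^{\overline{k-\alpha}}}{\Gamma(k-\alpha+1)}\nabla^k f(a).$$ (2) If $f$ is a real-valued function defined on ${}_{b}\mathbb{N}$ and at the points $b+1,\dots,b+n-1$ after $b$, then for all $t\in{}_{b-1}\mathbb{N}$ $${}_{b}^{C}\nabla^\alpha f(t)={}_{b}\nabla^\alpha f(t)-\sum_{k=0}^{n-1}\frac{(b-t)^{\overline{k-\alpha}}}{\Gamma(k-\alpha+1)}\,{}_{\ominus}\Delta^k f(b).$$ In particular, when $0<\alpha<1$, $${}^{C}\nabla_a^\alpha f(t)=\nabla_a^\alpha f(t)-\frac{(t-a)^{\overline{-\alpha}}}{\Gamma(1-\alpha)}f(a)\quad\text{and}\quad {}_{b}^{C}\nabla^\alpha f(t)={}_{b}\nabla^\alpha f(t)-\frac{(b-t)^{\overline{-\alpha}}}{\Gamma(1-\alpha)}f(b).$$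
   Context: Notation: $\mathbb{N}_a=\{a,a+1,\dots\}$, ${}_{b}\mathbb{N}=\{b,b-1,\dots\}$; $\Delta f(t)=f(t+1)-f(t)$, $\nabla f(t)=f(t)-f(t-1)$, with $\Delta^m,\nabla^m$ their iterates; ${}_{\ominus}\Delta^m f(t)=(-1)^m\Delta^m f(t)$; $\rho(t)=t-1$. Rising function: $t^{\overline{\beta}}=\Gamma(t+\beta)/\Gamma(t)$. For $\nu>0$: the nabla left fractional sum is $\nabla_a^{-\nu}f(t)=\frac{1}{\Gamma(\nu)}\sum_{s=a+1}^{t}(t-\rho(s))^{\overline{\nu-1}}f(s)$ and the nabla right fractional sum is ${}_{b}\nabla^{-\nu}f(t)=\frac{1}{\Gamma(\nu)}\sum_{s=t}^{b-1}(s-\rho(t))^{\overline{\nu-1}}f(s)$. These are $0$ when the range of summation is empty ($t\le a$, respectively $t\ge b$, with $t-a$, resp. $b-t$, an integer). For $\nu=0$: $\nabla_a^{-0}f(t)=f(t)$ for $t\in\mathbb{N}_{a+1}$ and $0$ for $t\le a$; ${}_{b}\nabla^{-0}f(t)=f(t)$ for $t\in{}_{b-1}\mathbb{N}$ and $0$ for $t\ge b$. With $n-1<\alpha\le n$, the nabla (Riemann) fractional differences are $\nabla_a^\alpha f(t)=\nabla^n\big(\nabla_a^{-(n-\alpha)}f\big)(t)$ for $t\in\mathbb{N}_{a+1}$ and ${}_{b}\nabla^\alpha f(t)={}_{\ominus}\Delta^n\big({}_{b}\nabla^{-(n-\alpha)}f\big)(t)$ for $t\in{}_{b-1}\mathbb{N}$.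 The nabla Caputo fractional differences are ${}^{C}\nabla_a^\alpha f(t)=\nabla_a^{-(n-\alpha)}(\nabla^n f)(t)$ and ${}_{b}^{C}\nabla^\alpha f(t)={}_{b}\nabla^{-(n-\alpha)}({}_{\ominus}\Delta^n f)(t)$ (for $\alpha=n$ these are $\nabla^n f(t)$ and ${}_{\ominus}\Delta^n f(t)$). Convention: for a positive integer $x$ and real $\beta$, the quotient $x^{\overline{\beta}}/\Gamma(\beta+1)=\Gamma(x+\beta)/(\Gamma(x)\Gamma(\beta+1))$ is read, when Gamma factors have poles, as its limiting value $\frac{1}{(x-1)!}\prod_{j=1}^{x-1}(\beta+j)$; in particular it is $0$ when only the denominator has a pole. *)

theory Defs
  imports "HOL-Analysis.Gamma_Function"
begin

definition nats_from :: "real \<Rightarrow> real set" where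
  "nats_from a = {a + real k | k. True}"

definition nats_down :: "real \<Rightarrow> real set" where
  "nats_down b = {b - real k | k. True}"

definition fwd_diff :: "(real \<Rightarrow> real) \<Rightarrow> real \<Rightarrow> real" where
  "fwd_diff f t = f (t + 1) - f t"

definition bwd_diff :: "(real \<Rightarrow> real) \<Rightarrow> real \<Rightarrow> real" where
  "bwd_diff f t = f t - f (t - 1)"

definition ominus_fwd_diff :: "nat \<Rightarrow> (real \<Rightarrow> real) \<Rightarrow> real \<Rightarrow> real" where
  "ominus_fwd_diff m f t = (-1) ^ m * (fwd_diff ^^ m) f t"

definition rho :: "real \<Rightarrow> real" where
  "rho t = t - 1"

definition rising :: "real \<Rightarrow> real \<Rightarrow> real" where
  "rising t \<beta> = Gamma (t + \<beta>) / Gamma t"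

text \<open>
  The quotient of \<open>rising x \<beta>\<close> by \<open>Gamma (\<beta> + 1)\<close>, for \<open>x\<close> a positive integer. If \<open>\<beta> + 1\<close> is a
  pole of Gamma, it is read as its limiting value at \<open>\<beta>\<close>. (Since \<open>x\<close> is a positive integer,
  \<open>x + \<beta>\<close> can only be a pole when \<open>\<beta> + 1\<close> is.) The totalised HOL quotient would give 0 there,
  which is wrong when \<open>x + \<beta>\<close> is a pole as well.
\<close>
definition rising_quot :: "real \<Rightarrow> real \<Rightarrow> real" where
  "rising_quot x \<beta> =
     (if \<beta> + 1 \<in> \<int>\<^sub>\<le>\<^sub>0
      then (\<Prod>j = 1..nat \<lfloor>x\<rfloor> - 1. \<beta> + real j) / fact (nat \<lfloor>x\<rfloor> - 1)
      else rising x \<beta> / Gamma (\<beta> + 1))"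

text \<open>
  Fractional sums of order \<open>-\<nu>\<close>, for \<open>\<nu> \<ge> 0\<close>. For \<open>t\<close> in the lattice of \<open>a\<close> (resp. \<open>b\<close>) the
  index sets are \<open>{a+1, \<dots>, t}\<close> and \<open>{t, \<dots>, b-1}\<close>, which are empty for \<open>t \<le> a\<close> and \<open>t \<ge> b\<close>.
\<close>
definition nabla_left_sum :: "real \<Rightarrow> real \<Rightarrow> (real \<Rightarrow> real) \<Rightarrow> real \<Rightarrow> real" where
  "nabla_left_sum a \<nu> f t =
     (if \<nu> = 0 then (if t \<in> nats_from (a + 1) then f t else 0)
      else 1 / Gamma \<nu> *
        (\<Sum>s \<in> nats_from (a + 1) \<inter> {..t}. rising (t - rho s) (\<nu> - 1) * f s))"

definition nabla_right_sum :: "real \<Rightarrow> real \<Rightarrow> (real \<Rightarrow> real) \<Rightarrow> real \<Rightarrow> real" where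
  "nabla_right_sum b \<nu> f t =
     (if \<nu> = 0 then (if t \<in> nats_down (b - 1) then f t else 0)
      else 1 / Gamma \<nu> *
        (\<Sum>s \<in> nats_down (b - 1) \<inter> {t..}. rising (s - rho t) (\<nu> - 1) * f s))"

text \<open>
  Fractional differences of order \<open>\<alpha> > 0\<close>; \<open>nat \<lceil>\<alpha>\<rceil>\<close> is the positive integer \<open>n\<close> with
  \<open>n - 1 < \<alpha> \<le> n\<close>.
\<close>
definition nabla_left_diff :: "real \<Rightarrow> real \<Rightarrow> (real \<Rightarrow> real) \<Rightarrow> real \<Rightarrow> real" where
  "nabla_left_diff a \<alpha> f t =
     (let n = nat \<lceil>\<alpha>\<rceil> in (bwd_diff ^^ n) (nabla_left_sum a (real n - \<alpha>) f) t)"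

definition nabla_right_diff :: "real \<Rightarrow> real \<Rightarrow> (real \<Rightarrow> real) \<Rightarrow> real \<Rightarrow> real" where
  "nabla_right_diff b \<alpha> f t =
     (let n = nat \<lceil>\<alpha>\<rceil> in ominus_fwd_diff n (nabla_right_sum b (real n - \<alpha>) f) t)"

definition caputo_left_diff :: "real \<Rightarrow> real \<Rightarrow> (real \<Rightarrow> real) \<Rightarrow> real \<Rightarrow> real" where
  "caputo_left_diff a \<alpha> f t =
     (let n = nat \<lceil>\<alpha>\<rceil> in nabla_left_sum a (real n - \<alpha>) ((bwd_diff ^^ n) f) t)"

definition caputo_right_diff :: "real \<Rightarrow> real \<Rightarrow> (real \<Rightarrow> real) \<Rightarrow> real \<Rightarrow> real" where
  "caputo_right_diff b \<alpha> f t =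
     (let n = nat \<lceil>\<alpha>\<rceil> in nabla_right_sum b (real n - \<alpha>) (ominus_fwd_diff n f) t)"

end

theory Submission
  imports Defs
begin

text \<open>
  On the lattice of \<open>a\<close>, the fractional sum of order \<open>\<nu>\<close> is a truncated convolution: at
  \<open>t = a + j\<close> it equals the sum over \<open>0 \<le> i < j\<close> of \<open>w \<nu> i * f (t - i)\<close>, where
  \<open>w \<nu> i = pochhammer \<nu> i / fact i\<close> is the coefficient of \<open>x ^ i\<close> in \<open>(1 - x) powr (-\<nu>)\<close>
  (\<open>binomial_weight\<close> below). This also covers \<open>\<nu> = 0\<close>, whose only nonzero weight is \<open>w 0 0 = 1\<close>.

  The backward difference would commute with an untruncated convolution. The truncated sum of
  \<open>\<nabla> f\<close> contains one term in \<open>f a\<close>, which the sum of \<open>f\<close> omits at \<open>t - 1\<close>, so that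
  \<open>\<nabla> (S f) t = S (\<nabla> f) t + w \<nu> (t - a - 1) * f a\<close> for \<open>t\<close> beyond \<open>a\<close>, with \<open>S\<close> the sum of order \<open>\<nu>\<close>
  (lemma \<open>bwd_diff_nabla_left_sum\<close>). The backward difference multiplies generating functions by
  \<open>1 - x\<close>, hence takes the weights of order \<open>\<nu>\<close> to those of order \<open>\<nu> - 1\<close>
  (lemma \<open>shifted_weight_diff\<close>). Iterating \<open>n\<close> times with \<open>\<nu> = n - \<alpha>\<close>, the boundary value of
  \<open>\<nabla>\<^sup>k f\<close> enters at step \<open>k + 1\<close> and is differenced \<open>n - 1 - k\<close> more times, so its final factor is
  \<open>w (k + 1 - \<alpha>) (t - a - 1)\<close>. This is exactly the quotient of the rising function by Gamma
  in the formula, limiting values included, because \<open>w\<close> is polynomial in the order.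

  The right-hand formula is the left-hand one for \<open>s \<mapsto> f (- s)\<close> with base point \<open>- b\<close>:
  the reflection exchanges the two kinds of sums and differences.
\<close>

section \<open>Generalized binomial coefficients as weights\<close>

definition binomial_weight :: "real \<Rightarrow> nat \<Rightarrow> real" where
  "binomial_weight \<nu> i = pochhammer \<nu> i / fact i"

text \<open>
  The weights with index lowered by one and extended by zero to all integers, so that difference
  identities hold on the whole lattice: iterated backward differences at a point to the right of \<open>a\<close>
  reach across \<open>a\<close>.
\<close>
definition shifted_weight :: "real \<Rightarrow> int \<Rightarrow> real" where
  "shifted_weight \<nu> j = (if j \<le> 0 then 0 else binomial_weight \<nu> (nat (j - 1)))"

lemma binomial_weight_0: "binomial_weight 0 i = (if i = 0 then 1 else 0)"
  by (cases i) (simp_all add: binomial_weight_def pochhammer_rec)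

text \<open>
  Pascal's rule for the generalized binomial coefficients; equivalently, the identity
  \<open>(1 - x) * (1 - x) powr (-\<nu>) = (1 - x) powr (-(\<nu> - 1))\<close> read off at \<open>x ^ Suc i\<close>.
\<close>
lemma binomial_weight_diff:
  "binomial_weight \<nu> (Suc i) - binomial_weight \<nu> i = binomial_weight (\<nu> - 1) (Suc i)"
proof -
  have "binomial_weight \<nu> (Suc i) - binomial_weight \<nu> i
      = pochhammer \<nu> i * (\<nu> + real i) / (fact i * (real i + 1)) - pochhammer \<nu> i / fact i"
    by (simp add: binomial_weight_def pochhammer_Suc algebra_simps)
  also have "\<dots> = (\<nu> - 1) * pochhammer \<nu> i / (fact i * (real i + 1))"
    by (simp add: divide_simps) (simp add: algebra_simps)
  also have "\<dots> = binomial_weight (\<nu> - 1) (Suc i)"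
    by (simp add: binomial_weight_def pochhammer_rec algebra_simps)
  finally show ?thesis .
qed

lemma shifted_weight_diff:
  "shifted_weight \<nu> j - shifted_weight \<nu> (j - 1) = shifted_weight (\<nu> - 1) j"
proof -
  consider "j \<le> 0" | "j = 1" | "j \<ge> 2" by linarith
  then show ?thesis
  proof cases
    case 3
    then have "nat (j - 1) = Suc (nat (j - 2))" by linarith
    with 3 binomial_weight_diff[of \<nu> "nat (j - 2)"] show ?thesis
      by (simp add: shifted_weight_def)
  qed (simp_all add: shifted_weight_def binomial_weight_def)
qed

text \<open>
  Away from the poles this is the functional equation of Gamma; at the poles both sides are the same
  polynomial in the order.
\<close>
lemma rising_quot_eq_binomial_weight:
  "rising_quot (real (Suc m)) \<beta> = binomial_weight (\<beta> + 1) m"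
proof (cases "\<beta> + 1 \<in> \<int>\<^sub>\<le>\<^sub>0")
  case True
  have "(\<Prod>j = 1..m. \<beta> + real j) = pochhammer (\<beta> + 1) m"
    unfolding pochhammer_prod
    by (rule prod.reindex_bij_witness[where i = Suc and j = "\<lambda>j. j - 1"]) auto
  moreover have "nat \<lfloor>real (Suc m)\<rfloor> - 1 = m"
    by (metis diff_Suc_1 floor_of_nat nat_int)
  ultimately show ?thesis
    using True unfolding rising_quot_def binomial_weight_def by presburger
next
  case False
  then show ?thesis
    by (simp add: rising_quot_def rising_def binomial_weight_def pochhammer_Gamma
        Gamma_fact algebra_simps)
qed

section \<open>Left sums as truncated convolutions\<close>

lemma lattice_segment_image:
  "nats_from (a + 1) \<inter> {..a + of_int j} = (\<lambda>i. a + of_int j - real i) ` {..<nat j}"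
proof (intro equalityI subsetI)
  fix s assume "s \<in> nats_from (a + 1) \<inter> {..a + of_int j}"
  then obtain k where s: "s = a + 1 + real k" and "s \<le> a + of_int j"
    by (auto simp: nats_from_def)
  then have "real_of_int (int k + 1) \<le> real_of_int j" by simp
  then have k: "int k + 1 \<le> j" by (simp only: of_int_le_iff)
  then have "real (nat (j - 1 - int k)) = of_int j - 1 - real k" by simp
  with s k show "s \<in> (\<lambda>i. a + of_int j - real i) ` {..<nat j}"
    by (intro image_eqI[where x = "nat (j - 1 - int k)"]) auto
next
  fix s assume "s \<in> (\<lambda>i. a + of_int j - real i) ` {..<nat j}"
  then obtain i where i: "i < nat j" and s: "s = a + of_int j - real i" by auto
  then have "real (nat (j - 1 - int i)) = of_int j - 1 - real i" by simp
  with s have "s = a + 1 + real (nat (j - 1 - int i))" by simp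
  then have "s \<in> nats_from (a + 1)" unfolding nats_from_def by blast
  with s show "s \<in> nats_from (a + 1) \<inter> {..a + of_int j}" by simp
qed

text \<open>
  For \<open>\<nu> > 0\<close> the normalizing factor \<open>1 / Gamma \<nu>\<close> turns the kernel \<open>Gamma (i + \<nu>) / Gamma (i + 1)\<close>
  into \<open>pochhammer \<nu> i / fact i\<close>.
\<close>
lemma nabla_left_sum_convolution:
  assumes "\<nu> \<ge> 0"
  shows "nabla_left_sum a \<nu> f (a + of_int j)
       = (\<Sum>i<nat j. binomial_weight \<nu> i * f (a + of_int j - real i))"
proof (cases "\<nu> = 0")
  case True
  have "a + of_int j \<in> nats_from (a + 1) \<longleftrightarrow> 0 < nat j"
  proof
    assume "a + of_int j \<in> nats_from (a + 1)"
    then have "a + of_int j \<in> nats_from (a + 1) \<inter> {..a + of_int j}" by simp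
    then show "0 < nat j" unfolding lattice_segment_image by auto
  next
    assume "0 < nat j"
    then have "a + of_int j \<in> (\<lambda>i. a + of_int j - real i) ` {..<nat j}"
      by (intro image_eqI[where x = 0]) auto
    then show "a + of_int j \<in> nats_from (a + 1)"
      unfolding lattice_segment_image[symmetric] by simp
  qed
  moreover have "(\<Sum>i<nat j. binomial_weight 0 i * f (a + of_int j - real i))
      = (\<Sum>i<nat j. if i = 0 then f (a + of_int j) else 0)"
    by (intro sum.cong) (auto simp: binomial_weight_0)
  ultimately show ?thesis
    using True by (simp add: nabla_left_sum_def)
next
  case False
  with assms have pos: "\<nu> > 0" by simp
  then have nonpole: "\<nu> \<notin> \<int>\<^sub>\<le>\<^sub>0" using nonpos_Ints_nonpos not_le by blast
  have "inj_on (\<lambda>i. a + of_int j - real i) {..<nat j}"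
    by (auto simp: inj_on_def)
  then have "nabla_left_sum a \<nu> f (a + of_int j)
      = (\<Sum>i<nat j. 1 / Gamma \<nu> * (rising (real i + 1) (\<nu> - 1) * f (a + of_int j - real i)))"
    using False
    by (simp add: nabla_left_sum_def lattice_segment_image sum.reindex rho_def sum_distrib_left)
  also have "\<dots> = (\<Sum>i<nat j. binomial_weight \<nu> i * f (a + of_int j - real i))"
    using nonpole
    by (intro sum.cong)
      (simp_all add: rising_def binomial_weight_def pochhammer_Gamma add.commute
        Gamma_fact[of _, simplified add.commute])
  finally show ?thesis .
qed

text \<open>
  With \<open>t = a + j\<close>, differencing the convolution sum directly leaves one fewer term at \<open>t - 1\<close> than
  at \<open>t\<close>; the unmatched term has index \<open>j - 1\<close> and contains \<open>g a\<close>.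
\<close>
lemma bwd_diff_nabla_left_sum:
  assumes "\<nu> \<ge> 0"
  shows "nabla_left_sum a \<nu> g (a + of_int j) - nabla_left_sum a \<nu> g (a + of_int (j - 1))
       = nabla_left_sum a \<nu> (bwd_diff g) (a + of_int j) + shifted_weight \<nu> j * g a"
proof (cases "j \<le> 0")
  case True
  then show ?thesis
    by (simp add: nabla_left_sum_convolution[OF assms] shifted_weight_def del: of_int_diff)
next
  case False
  define m where "m = nat (j - 1)"
  have j: "j = int m + 1" using False by (simp add: m_def)
  have nj: "nat j = Suc m" "nat (j - 1) = m" by (simp_all add: j)
  have pt: "a + of_int (j - 1) = a + real m" by (simp add: j)
  have "nabla_left_sum a \<nu> (bwd_diff g) (a + of_int j)
      = (\<Sum>i<Suc m. binomial_weight \<nu> i * g (a + of_int j - real i))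
        - (\<Sum>i<Suc m. binomial_weight \<nu> i * g (a + real m - real i))"
    unfolding nabla_left_sum_convolution[OF assms] nj bwd_diff_def sum_subtractf[symmetric]
    by (intro sum.cong) (simp_all add: j algebra_simps)
  also have "\<dots> = nabla_left_sum a \<nu> g (a + of_int j)
      - (nabla_left_sum a \<nu> g (a + of_int (j - 1)) + binomial_weight \<nu> m * g a)"
    unfolding nabla_left_sum_convolution[OF assms] nj unfolding pt by simp
  finally show ?thesis
    using False by (simp add: shifted_weight_def nj)
qed

lemma funpow_bwd_diff_nabla_left_sum:
  assumes "\<nu> \<ge> 0"
  shows "(bwd_diff ^^ n) (nabla_left_sum a \<nu> f) (a + of_int j)
       = nabla_left_sum a \<nu> ((bwd_diff ^^ n) f) (a + of_int j)
         + (\<Sum>k<n. shifted_weight (\<nu> - real n + 1 + real k) j * (bwd_diff ^^ k) f a)"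
proof (induction n arbitrary: j)
  case 0
  show ?case by simp
next
  case (Suc n)
  let ?g = "(bwd_diff ^^ n) f"
  let ?W = "\<lambda>k. shifted_weight (\<nu> - real n + 1 + real k)"
  have "(bwd_diff ^^ Suc n) (nabla_left_sum a \<nu> f) (a + of_int j)
      = (bwd_diff ^^ n) (nabla_left_sum a \<nu> f) (a + of_int j)
        - (bwd_diff ^^ n) (nabla_left_sum a \<nu> f) (a + of_int (j - 1))"
    by (simp add: bwd_diff_def add_diff_eq)
  also have "\<dots> = (nabla_left_sum a \<nu> ?g (a + of_int j) - nabla_left_sum a \<nu> ?g (a + of_int (j - 1)))
      + (\<Sum>k<n. (?W k j - ?W k (j - 1)) * (bwd_diff ^^ k) f a)"
    unfolding Suc.IH by (simp add: sum_subtractf left_diff_distrib del: of_int_diff)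
  also have "\<dots> = nabla_left_sum a \<nu> (bwd_diff ?g) (a + of_int j) + shifted_weight \<nu> j * ?g a
      + (\<Sum>k<n. shifted_weight (\<nu> - real (Suc n) + 1 + real k) j * (bwd_diff ^^ k) f a)"
    unfolding bwd_diff_nabla_left_sum[OF assms] shifted_weight_diff
    by (simp add: algebra_simps)
  also have "\<dots> = nabla_left_sum a \<nu> ((bwd_diff ^^ Suc n) f) (a + of_int j)
      + (\<Sum>k<Suc n. shifted_weight (\<nu> - real (Suc n) + 1 + real k) j * (bwd_diff ^^ k) f a)"
    by simp
  finally show ?case .
qed

lemma caputo_left_diff_eq:
  assumes "n = nat \<lceil>\<alpha>\<rceil>" and "t \<in> nats_from (a + 1)"
  shows "caputo_left_diff a \<alpha> f t = nabla_left_diff a \<alpha> f t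
           - (\<Sum>k<n. rising_quot (t - a) (real k - \<alpha>) * (bwd_diff ^^ k) f a)"
proof -
  obtain m where t: "t = a + of_int (int (Suc m))"
    using assms(2) by (auto simp: nats_from_def algebra_simps)
  have "real n - \<alpha> \<ge> 0"
    unfolding assms(1) by (rule diff_ge_0_iff_ge[THEN iffD2, OF real_nat_ceiling_ge])
  from funpow_bwd_diff_nabla_left_sum[OF this, of n a f "int (Suc m)"]
  have "nabla_left_diff a \<alpha> f t = caputo_left_diff a \<alpha> f t
      + (\<Sum>k<n. binomial_weight (real k - \<alpha> + 1) m * (bwd_diff ^^ k) f a)"
    unfolding nabla_left_diff_def caputo_left_diff_def Let_def assms(1)[symmetric] t
    by (simp add: shifted_weight_def algebra_simps)
  moreover have "t - a = real (Suc m)" by (simp add: t)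
  ultimately show ?thesis
    by (simp only: rising_quot_eq_binomial_weight)
qed

section \<open>Reflection to right sums\<close>

text \<open>
  The sign \<open>(-1) ^ m\<close> is what makes the operator the mirror image of the iterated backward
  difference.
\<close>
lemma ominus_fwd_diff_reflect:
  "ominus_fwd_diff m f t = (bwd_diff ^^ m) (\<lambda>s. f (- s)) (- t)"
proof (induction m arbitrary: t)
  case 0
  show ?case by (simp add: ominus_fwd_diff_def)
next
  case (Suc m)
  have "ominus_fwd_diff (Suc m) f t = ominus_fwd_diff m f t - ominus_fwd_diff m f (t + 1)"
    by (simp add: ominus_fwd_diff_def fwd_diff_def algebra_simps)
  also have "\<dots> = (bwd_diff ^^ m) (\<lambda>s. f (- s)) (- t) - (bwd_diff ^^ m) (\<lambda>s. f (- s)) (- t - 1)"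
    by (simp add: Suc.IH)
  also have "\<dots> = (bwd_diff ^^ Suc m) (\<lambda>s. f (- s)) (- t)"
    by (simp add: bwd_diff_def)
  finally show ?case .
qed

lemma nats_down_iff_reflect: "t \<in> nats_down (b - 1) \<longleftrightarrow> - t \<in> nats_from (- b + 1)"
proof -
  have "t = b - 1 - real k \<longleftrightarrow> - t = - b + 1 + real k" for k by linarith
  then show ?thesis by (simp add: nats_down_def nats_from_def)
qed

lemma nabla_right_sum_reflect:
  "nabla_right_sum b \<nu> f t = nabla_left_sum (- b) \<nu> (\<lambda>s. f (- s)) (- t)"
proof -
  have reflected_arg: "- t - rho (- s) = s - rho t" for s
    by (simp add: rho_def)
  have "(\<Sum>s \<in> nats_down (b - 1) \<inter> {t..}. rising (s - rho t) (\<nu> - 1) * f s)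
      = (\<Sum>s \<in> nats_from (- b + 1) \<inter> {..- t}. rising (- t - rho s) (\<nu> - 1) * f (- s))"
    by (rule sum.reindex_bij_witness[where i = uminus and j = uminus])
      (auto simp: nats_down_iff_reflect reflected_arg)
  then show ?thesis
    by (simp add: nabla_right_sum_def nabla_left_sum_def nats_down_iff_reflect)
qed

lemma nabla_right_diff_reflect:
  "nabla_right_diff b \<alpha> f t = nabla_left_diff (- b) \<alpha> (\<lambda>s. f (- s)) (- t)"
  by (simp add: nabla_right_diff_def nabla_left_diff_def Let_def ominus_fwd_diff_reflect
      nabla_right_sum_reflect)

lemma caputo_right_diff_reflect:
  "caputo_right_diff b \<alpha> f t = caputo_left_diff (- b) \<alpha> (\<lambda>s. f (- s)) (- t)"
  by (simp add: caputo_right_diff_def caputo_left_diff_def Let_def ominus_fwd_diff_reflect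
      nabla_right_sum_reflect)

lemma caputo_right_diff_eq:
  assumes "n = nat \<lceil>\<alpha>\<rceil>" and "t \<in> nats_down (b - 1)"
  shows "caputo_right_diff b \<alpha> f t = nabla_right_diff b \<alpha> f t
           - (\<Sum>k<n. rising_quot (b - t) (real k - \<alpha>) * ominus_fwd_diff k f b)"
  using caputo_left_diff_eq[OF assms(1), of "- t" "- b" "\<lambda>s. f (- s)"] assms(2)
  by (simp add: nats_down_iff_reflect caputo_right_diff_reflect nabla_right_diff_reflect
      ominus_fwd_diff_reflect)

section \<open>Comparison of Caputo and Riemann differences\<close>

theorem theorem4p3:
  fixes \<alpha> a b :: real and n :: nat
  assumes "\<alpha> > 0" and "n \<ge> 1" and "real n - 1 < \<alpha>" and "\<alpha> \<le> real n"
  shows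
    "(\<forall>(f :: real \<Rightarrow> real). \<forall>t \<in> nats_from (a + 1).
        caputo_left_diff a \<alpha> f t =
          nabla_left_diff a \<alpha> f t
            - (\<Sum>k = 0..n - 1. rising_quot (t - a) (real k - \<alpha>) * (bwd_diff ^^ k) f a))
     \<and>
     (\<forall>(f :: real \<Rightarrow> real). \<forall>t \<in> nats_down (b - 1).
        caputo_right_diff b \<alpha> f t =
          nabla_right_diff b \<alpha> f t
            - (\<Sum>k = 0..n - 1. rising_quot (b - t) (real k - \<alpha>) * ominus_fwd_diff k f b))
     \<and>
     (0 < \<alpha> \<and> \<alpha> < 1 \<longrightarrow>
        (\<forall>(f :: real \<Rightarrow> real). \<forall>t \<in> nats_from (a + 1).
           caputo_left_diff a \<alpha> f t =
             nabla_left_diff a \<alpha> f t - rising (t - a) (- \<alpha>) / Gamma (1 - \<alpha>) * f a)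
        \<and>
        (\<forall>(f :: real \<Rightarrow> real). \<forall>t \<in> nats_down (b - 1).
           caputo_right_diff b \<alpha> f t =
             nabla_right_diff b \<alpha> f t - rising (b - t) (- \<alpha>) / Gamma (1 - \<alpha>) * f b))"
proof -
  have n: "n = nat \<lceil>\<alpha>\<rceil>"
    using assms by (simp add: ceiling_unique[of "int n"])
  have idx: "{0..n - 1} = {..<n}" using assms(2) by auto
  have part1: "caputo_left_diff a \<alpha> f t = nabla_left_diff a \<alpha> f t
      - (\<Sum>k = 0..n - 1. rising_quot (t - a) (real k - \<alpha>) * (bwd_diff ^^ k) f a)"
    if "t \<in> nats_from (a + 1)" for f t
    unfolding idx by (rule caputo_left_diff_eq[OF n that])
  have part2: "caputo_right_diff b \<alpha> f t = nabla_right_diff b \<alpha> f t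
      - (\<Sum>k = 0..n - 1. rising_quot (b - t) (real k - \<alpha>) * ominus_fwd_diff k f b)"
    if "t \<in> nats_down (b - 1)" for f t
    unfolding idx by (rule caputo_right_diff_eq[OF n that])
  have single: "n = 1 \<and> (\<forall>x. rising_quot x (- \<alpha>) = rising x (- \<alpha>) / Gamma (1 - \<alpha>))"
    if "\<alpha> < 1"
  proof -
    have "1 - \<alpha> \<notin> \<int>\<^sub>\<le>\<^sub>0" using that nonpos_Ints_nonpos by fastforce
    then have "rising_quot x (- \<alpha>) = rising x (- \<alpha>) / Gamma (1 - \<alpha>)" for x
      by (simp add: rising_quot_def)
    moreover have "n = 1" using assms that by linarith
    ultimately show ?thesis by blast
  qed
  have part3: "caputo_left_diff a \<alpha> f t
      = nabla_left_diff a \<alpha> f t - rising (t - a) (- \<alpha>) / Gamma (1 - \<alpha>) * f a"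
    if "\<alpha> < 1" "t \<in> nats_from (a + 1)" for f t
    using part1[OF that(2)] single[OF that(1)] by simp
  have part4: "caputo_right_diff b \<alpha> f t
      = nabla_right_diff b \<alpha> f t - rising (b - t) (- \<alpha>) / Gamma (1 - \<alpha>) * f b"
    if "\<alpha> < 1" "t \<in> nats_down (b - 1)" for f t
    using part2[OF that(2)] single[OF that(1)] by (simp add: ominus_fwd_diff_def)
  show ?thesis
    using part1 part2 part3 part4 by blast
qed

end
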